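(* Let $R$ be a finite rack with operations $\triangleright,\triangleleft$, let $G$ be an arbitrary group structure on the underlying set of $R$ (no compatibility with the rack operations is assumed), let $\mathcal G=(\mathrm{id}\colon G\to G,\mathrm{ad})$ be the crossed module given by the identity map and the conjugation action, and let $\Phi=(\psi,\phi)$ be the framed Reidemeister pair $\psi(b,a)=b\,a\,b^{-1}(b\triangleright a)^{-1}$, $\phi(b,a)=a\,b\,(a\triangleleft b)^{-1}b^{-1}$. Then for every link diagram $D$, $$I_\Phi(D)=I_R(D)\,1_G,$$ where $I_R(D)$ is the number of rack colourings of $D$ by $R$ and $1_G$ is the identity of $G$. Therefore the class of invariants $I_\Phi$ is at least as strong as the class of rack link invariants: whenever $I_R(D)\neq I_R(D')$ for link diagrams $D,D'$, also $I_\Phi(D)\ne I_\Phi(D')$.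
   Context: **Racks.** A rack is a set $R$ with two operations $\triangleright,\triangleleft\colon R\times R\to R$ such that for all $x,y,z\in R$: $x\triangleright(y\triangleleft x)=y$; $(x\triangleright y)\triangleleft x=y$; $x\triangleright(y\triangleright z)=(x\triangleright y)\triangleright(x\triangleright z)$; $(x\triangleleft y)\triangleleft z=(x\triangleleft z)\triangleleft(y\triangleleft z)$. A rack colouring of an oriented diagram assigns an element of $R$ to each arc so that: at each crossing $X_+$ with over-arc coloured $y$ and lower (bottom right) under-arc coloured $x$, the upper (top left) under-arc is coloured $y\triangleright x$; at each crossing $X_-$ with over-arc coloured $y$ and lower (bottom left) under-arc coloured $x$, the upper (top right) under-arc is coloured $x\triangleleft y$. $I_R(D)$ is the number of rack colourings of the link diagram $D$. **Diagrams.** An oriented tangle diagram is sliced into horizontal strips, each containing vertical strands and at most one elementary piece: the crossing $X_+$ (both strands oriented downwards, over-strand from top right to bottom left, under-strand from top left to bottom right), the crossing $X_-$ (both strands oriented downwards, over-strand from top left to bottom right, under-strand from top right to bottom left), and cups (local minima) and caps (local maxima) with either orientation. Crossings with upward strands are expressed through these pieces. A link diagram is a tangle diagram without end-points. **Crossed modules.** A crossed module of groups $\mathcal G=(\partial\colon E\to G,\bullet)$ is a group homomorphism $\partial\colon E\to G$ with a left action $\bullet$ of $G$ on $E$ by automorphisms such that $\partial(g\bullet e)=g\,\partial(e)\,g^{-1}$ and $\partial(e)\bullet f=efe^{-1}$ for all $g\in G$, $e,f\in E$. **The category $\mathcal C(\mathcal G)$.** Objects are the elements of $G$. Morphisms $U\to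 V$ are pairs $(U,e)$ with $e\in E$, $\partial(e)=VU^{-1}$ (written $U\xrightarrow{e}V$). The composite of $U\xrightarrow{e}V$ followed by $V\xrightarrow{f}W$ is $U\xrightarrow{fe}W$. The tensor product is $U\otimes V=UV$ on objects, and the tensor product of $U\xrightarrow{e}V$ and $W\xrightarrow{f}X$ is $UW\xrightarrow{(V\bullet f)\,e}VX$. **Reidemeister pairs.** A pair $\Phi=(\psi,\phi)$ of functions $\psi,\phi\colon G\times G\to E$ is a *framed Reidemeister pair* if for all $X,Y,T\in G$: (R2) $\phi(X,Y)\,\psi(X,Z)=1_E$ where $Z=X^{-1}\partial\phi(X,Y)^{-1}YX$; (R3) $\phi(Y,X)\cdot(Y\bullet\phi(T,Z))\cdot\phi(T,Y)=(X\bullet\phi(T,Y))\cdot\phi(T,X)\cdot(T\bullet\phi(V,W))$ where $Z=Y^{-1}\partial\phi(Y,X)^{-1}XY$, $V=T^{-1}\partial\phi(T,Y)^{-1}YT$, $W=T^{-1}\partial\phi(T,X)^{-1}XT$; and moreover (i) for each $Z\in G$ the equation $\partial(\phi(A,Z))A=Z$ has a unique solution $A=f(Z)\in G$; (ii) with $g(A)=\partial(\psi(A,A))^{-1}A$ one has $f\circ g=g\circ f=\mathrm{id}$. **Reidemeister $\mathcal G$-colourings and state sum.** A Reidemeister $\mathcal G$-colouring $F$ of a link diagram $D$ assigns an element of $G$ to each arc and an element of $E$ to each crossing so that: at each $X_+$ with over-arc coloured $X$, lower (bottom right) under-arc coloured $Y$, upper (top left) under-arc coloured $Z$, the crossing is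 coloured $\psi(X,Y)$ and $Z=\partial\psi(X,Y)^{-1}XYX^{-1}$; at each $X_-$ with over-arc coloured $X$, lower (bottom left) under-arc coloured $Y$, upper (top right) under-arc coloured $Z$, the crossing is coloured $\phi(X,Y)$ and $Z=X^{-1}\partial\phi(X,Y)^{-1}YX$. The evaluation $e(F)$ is the morphism $1_G\to1_G$ of $\mathcal C(\mathcal G)$, i.e. an element of $A=\ker\partial$, obtained by tensoring horizontally and composing vertically (from top to bottom) the following morphisms: $X_+\mapsto ZX\xrightarrow{\psi(X,Y)}XY$; $X_-\mapsto XZ\xrightarrow{\phi(X,Y)}YX$; a vertical strand coloured $X$ gives the identity of $X$ if oriented downwards and of $X^{-1}$ if upwards; cups give $XX^{-1}\xrightarrow{1_E}1_G$ or $X^{-1}X\xrightarrow{1_E}1_G$ and caps give $1_G\xrightarrow{1_E}X^{-1}X$ or $1_G\xrightarrow{1_E}XX^{-1}$, according to orientation. The state sum is $I_\Phi(D)=\sum_F e(F)\in\mathbb Z[A]$, the sum being over all Reidemeister $\mathcal G$-colourings of $D$. *)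

theory Defs
  imports "HOL-Algebra.Group" "HOL-Library.Poly_Mapping"
begin

locale rack =
  fixes R :: "'a set"
    and lop :: "'a \<Rightarrow> 'a \<Rightarrow> 'a"  (infix "\<triangleright>" 70)
    and rop :: "'a \<Rightarrow> 'a \<Rightarrow> 'a"  (infix "\<triangleleft>" 70)
  assumes lop_closed: "\<lbrakk>x \<in> R; y \<in> R\<rbrakk> \<Longrightarrow> x \<triangleright> y \<in> R"
    and rop_closed: "\<lbrakk>x \<in> R; y \<in> R\<rbrakk> \<Longrightarrow> x \<triangleleft> y \<in> R"
    and lop_rop: "\<lbrakk>x \<in> R; y \<in> R\<rbrakk> \<Longrightarrow> x \<triangleright> (y \<triangleleft> x) = y"
    and rop_lop: "\<lbrakk>x \<in> R; y \<in> R\<rbrakk> \<Longrightarrow> (x \<triangleright> y) \<triangleleft> x = y"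
    and lop_distrib: "\<lbrakk>x \<in> R; y \<in> R; z \<in> R\<rbrakk> \<Longrightarrow> x \<triangleright> (y \<triangleright> z) = (x \<triangleright> y) \<triangleright> (x \<triangleright> z)"
    and rop_distrib: "\<lbrakk>x \<in> R; y \<in> R; z \<in> R\<rbrakk> \<Longrightarrow> (x \<triangleleft> y) \<triangleleft> z = (x \<triangleleft> z) \<triangleleft> (y \<triangleleft> z)"

datatype orient = Down | Up

fun opp :: "orient \<Rightarrow> orient" where
  "opp Down = Up"
| "opp Up = Down"

text \<open>The argument of \<open>Cup\<close> (a local minimum) and of \<open>Cap\<close> (a local maximum) is the orientation
  of the left leg; the right leg has the opposite orientation.\<close>

datatype piece = Strand orient | XPos | XNeg | Cup orient | Cap orient

fun piece_top :: "piece \<Rightarrow> orient list" where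
  "piece_top (Strand u) = [u]"
| "piece_top XPos = [Down, Down]"
| "piece_top XNeg = [Down, Down]"
| "piece_top (Cup u) = [u, opp u]"
| "piece_top (Cap u) = []"

fun piece_bot :: "piece \<Rightarrow> orient list" where
  "piece_bot (Strand u) = [u]"
| "piece_bot XPos = [Down, Down]"
| "piece_bot XNeg = [Down, Down]"
| "piece_bot (Cup u) = []"
| "piece_bot (Cap u) = [u, opp u]"

text \<open>A strip lists its pieces from left to right, a diagram lists its strips from top to bottom.\<close>

type_synonym strip = "piece list"
type_synonym diagram = "strip list"

definition strip_top :: "strip \<Rightarrow> orient list" where
  "strip_top s = concat (map piece_top s)"

definition strip_bot :: "strip \<Rightarrow> orient list" where
  "strip_bot s = concat (map piece_bot s)"

definition elementary :: "strip \<Rightarrow> bool" where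
  "elementary s \<longleftrightarrow> length (filter (\<lambda>p. \<forall>u. p \<noteq> Strand u) s) \<le> 1"

fun tangle :: "orient list \<Rightarrow> diagram \<Rightarrow> orient list \<Rightarrow> bool" where
  "tangle a [] b \<longleftrightarrow> a = b"
| "tangle a (s # D) b \<longleftrightarrow> elementary s \<and> strip_top s = a \<and> tangle (strip_bot s) D b"

definition link_diagram :: "diagram \<Rightarrow> bool" where
  "link_diagram D \<longleftrightarrow> tangle [] D []"

text \<open>The point \<open>(k, j)\<close> is the \<open>j\<close>-th intersection point (from the left) of the diagram with the
  horizontal line bounding strip \<open>k\<close> from above, i.e. bounding strip \<open>k - 1\<close> from below.
  The \<open>m\<close>-th piece of strip \<open>k\<close> has end-points \<open>tpt D k m 0\<close>, \<open>tpt D k m 1\<close>, ... on its top and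
  \<open>bpt D k m 0\<close>, \<open>bpt D k m 1\<close>, ... on its bottom.\<close>

type_synonym point = "nat \<times> nat"

definition tpt :: "diagram \<Rightarrow> nat \<Rightarrow> nat \<Rightarrow> nat \<Rightarrow> point" where
  "tpt D k m i = (k, length (strip_top (take m (D ! k))) + i)"

definition bpt :: "diagram \<Rightarrow> nat \<Rightarrow> nat \<Rightarrow> nat \<Rightarrow> point" where
  "bpt D k m i = (Suc k, length (strip_bot (take m (D ! k))) + i)"

definition points :: "diagram \<Rightarrow> point set" where
  "points D = {(k, j). k < length D \<and> j < length (strip_top (D ! k))}
            \<union> {(Suc k, j) | k j. k < length D \<and> j < length (strip_bot (D ! k))}"

definition piece_at :: "diagram \<Rightarrow> nat \<Rightarrow> nat \<Rightarrow> piece \<Rightarrow> bool" where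
  "piece_at D k m p \<longleftrightarrow> k < length D \<and> m < length (D ! k) \<and> D ! k ! m = p"

text \<open>Two end-points of a piece are linked if a strand of that piece joins them, other than the
  under-strand of a crossing. The over-strand of \<open>XPos\<close> runs from top right to bottom left, the one
  of \<open>XNeg\<close> from top left to bottom right.\<close>

inductive linked :: "diagram \<Rightarrow> point \<Rightarrow> point \<Rightarrow> bool" for D where
  "piece_at D k m (Strand u) \<Longrightarrow> linked D (tpt D k m 0) (bpt D k m 0)"
| "piece_at D k m XPos \<Longrightarrow> linked D (tpt D k m 1) (bpt D k m 0)"
| "piece_at D k m XNeg \<Longrightarrow> linked D (tpt D k m 0) (bpt D k m 1)"
| "piece_at D k m (Cup u) \<Longrightarrow> linked D (tpt D k m 0) (tpt D k m 1)"
| "piece_at D k m (Cap u) \<Longrightarrow> linked D (bpt D k m 0) (bpt D k m 1)"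

type_synonym arc = "point set"

definition arc_of :: "diagram \<Rightarrow> point \<Rightarrow> arc" where
  "arc_of D p = {q. equivclp (linked D) p q}"

definition arcs :: "diagram \<Rightarrow> arc set" where
  "arcs D = arc_of D ` points D"

type_synonym crossing = "nat \<times> nat"

definition crossings :: "diagram \<Rightarrow> crossing set" where
  "crossings D = {(k, m). piece_at D k m XPos \<or> piece_at D k m XNeg}"

text \<open>At a crossing, \<open>lower\<close> is the under-arc at the bottom and \<open>upper\<close> the under-arc at the top.\<close>

definition over :: "diagram \<Rightarrow> nat \<Rightarrow> nat \<Rightarrow> arc" where
  "over D k m = arc_of D (if piece_at D k m XPos then tpt D k m 1 else tpt D k m 0)"

definition lower :: "diagram \<Rightarrow> nat \<Rightarrow> nat \<Rightarrow> arc" where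
  "lower D k m = arc_of D (if piece_at D k m XPos then bpt D k m 1 else bpt D k m 0)"

definition upper :: "diagram \<Rightarrow> nat \<Rightarrow> nat \<Rightarrow> arc" where
  "upper D k m = arc_of D (if piece_at D k m XPos then tpt D k m 0 else tpt D k m 1)"

definition rack_colourings ::
  "'a set \<Rightarrow> ('a \<Rightarrow> 'a \<Rightarrow> 'a) \<Rightarrow> ('a \<Rightarrow> 'a \<Rightarrow> 'a) \<Rightarrow> diagram \<Rightarrow> (arc \<Rightarrow> 'a) set" where
  "rack_colourings R lop rop D = {c \<in> arcs D \<rightarrow>\<^sub>E R.
     (\<forall>k m. piece_at D k m XPos \<longrightarrow> c (upper D k m) = lop (c (over D k m)) (c (lower D k m))) \<and>
     (\<forall>k m. piece_at D k m XNeg \<longrightarrow> c (upper D k m) = rop (c (lower D k m)) (c (over D k m)))}"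

definition rack_count ::
  "'a set \<Rightarrow> ('a \<Rightarrow> 'a \<Rightarrow> 'a) \<Rightarrow> ('a \<Rightarrow> 'a \<Rightarrow> 'a) \<Rightarrow> diagram \<Rightarrow> nat" where
  "rack_count R lop rop D = card (rack_colourings R lop rop D)"

record ('e, 'g) xmod =
  xE :: "'e monoid"
  xG :: "'g monoid"
  bd :: "'e \<Rightarrow> 'g"
  act :: "'g \<Rightarrow> 'e \<Rightarrow> 'e"

locale crossed_module =
  fixes M :: "('e, 'g) xmod"
  assumes group_E: "group (xE M)"
    and group_G: "group (xG M)"
    and bd_hom: "bd M \<in> hom (xE M) (xG M)"
    and act_closed: "\<lbrakk>g \<in> carrier (xG M); e \<in> carrier (xE M)\<rbrakk> \<Longrightarrow> act M g e \<in> carrier (xE M)"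
    and act_one: "e \<in> carrier (xE M) \<Longrightarrow> act M \<one>\<^bsub>xG M\<^esub> e = e"
    and act_mult: "\<lbrakk>g \<in> carrier (xG M); h \<in> carrier (xG M); e \<in> carrier (xE M)\<rbrakk>
        \<Longrightarrow> act M (g \<otimes>\<^bsub>xG M\<^esub> h) e = act M g (act M h e)"
    and act_hom: "\<lbrakk>g \<in> carrier (xG M); e \<in> carrier (xE M); f \<in> carrier (xE M)\<rbrakk>
        \<Longrightarrow> act M g (e \<otimes>\<^bsub>xE M\<^esub> f) = act M g e \<otimes>\<^bsub>xE M\<^esub> act M g f"
    and bd_act: "\<lbrakk>g \<in> carrier (xG M); e \<in> carrier (xE M)\<rbrakk>
        \<Longrightarrow> bd M (act M g e) = g \<otimes>\<^bsub>xG M\<^esub> bd M e \<otimes>\<^bsub>xG M\<^esub> inv\<^bsub>xG M\<^esub> g"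
    and peiffer: "\<lbrakk>e \<in> carrier (xE M); f \<in> carrier (xE M)\<rbrakk>
        \<Longrightarrow> act M (bd M e) f = e \<otimes>\<^bsub>xE M\<^esub> f \<otimes>\<^bsub>xE M\<^esub> inv\<^bsub>xE M\<^esub> e"

definition conj_xmod :: "'a monoid \<Rightarrow> ('a, 'a) xmod" where
  "conj_xmod G = \<lparr> xE = G, xG = G, bd = (\<lambda>x. x), act = (\<lambda>g e. g \<otimes>\<^bsub>G\<^esub> e \<otimes>\<^bsub>G\<^esub> inv\<^bsub>G\<^esub> g) \<rparr>"

text \<open>The pair \<open>(U, e)\<close> is a morphism from \<open>U\<close> to \<open>V\<close> exactly when \<open>\<partial>(e) = V U\<^sup>-\<^sup>1\<close>, so the target
  is determined by the pair. Composition and tensor product are total functions on pairs; composition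
  is meaningful only if the target of the first morphism is the first component of the second.\<close>

type_synonym ('e, 'g) morphism = "'g \<times> 'e"

definition mor_target :: "('e, 'g) xmod \<Rightarrow> ('e, 'g) morphism \<Rightarrow> 'g" where
  "mor_target M a = bd M (snd a) \<otimes>\<^bsub>xG M\<^esub> fst a"

definition mor_id :: "('e, 'g) xmod \<Rightarrow> 'g \<Rightarrow> ('e, 'g) morphism" where
  "mor_id M U = (U, \<one>\<^bsub>xE M\<^esub>)"

text \<open>\<open>mor_comp M a b\<close> is \<open>a\<close> followed by \<open>b\<close>.\<close>

definition mor_comp ::
  "('e, 'g) xmod \<Rightarrow> ('e, 'g) morphism \<Rightarrow> ('e, 'g) morphism \<Rightarrow> ('e, 'g) morphism" where
  "mor_comp M a b = (fst a, snd b \<otimes>\<^bsub>xE M\<^esub> snd a)"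

definition mor_tensor ::
  "('e, 'g) xmod \<Rightarrow> ('e, 'g) morphism \<Rightarrow> ('e, 'g) morphism \<Rightarrow> ('e, 'g) morphism" where
  "mor_tensor M a b =
     (fst a \<otimes>\<^bsub>xG M\<^esub> fst b, act M (mor_target M a) (snd b) \<otimes>\<^bsub>xE M\<^esub> snd a)"

text \<open>The upper under-arc at a crossing, as a function of the over-arc \<open>X\<close> and the lower
  under-arc \<open>Y\<close>.\<close>

definition upper_pos :: "('e, 'g) xmod \<Rightarrow> ('g \<Rightarrow> 'g \<Rightarrow> 'e) \<Rightarrow> 'g \<Rightarrow> 'g \<Rightarrow> 'g" where
  "upper_pos M \<psi> X Y =
     inv\<^bsub>xG M\<^esub> (bd M (\<psi> X Y)) \<otimes>\<^bsub>xG M\<^esub> X \<otimes>\<^bsub>xG M\<^esub> Y \<otimes>\<^bsub>xG M\<^esub> inv\<^bsub>xG M\<^esub> X"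

definition upper_neg :: "('e, 'g) xmod \<Rightarrow> ('g \<Rightarrow> 'g \<Rightarrow> 'e) \<Rightarrow> 'g \<Rightarrow> 'g \<Rightarrow> 'g" where
  "upper_neg M \<phi> X Y =
     inv\<^bsub>xG M\<^esub> X \<otimes>\<^bsub>xG M\<^esub> inv\<^bsub>xG M\<^esub> (bd M (\<phi> X Y)) \<otimes>\<^bsub>xG M\<^esub> Y \<otimes>\<^bsub>xG M\<^esub> X"

text \<open>The maps \<open>f\<close> and \<open>g\<close> of a framed Reidemeister pair; \<open>f\<close> is meaningful only when the
  uniqueness condition \<open>f_unique\<close> below holds.\<close>

definition rp_f :: "('e, 'g) xmod \<Rightarrow> ('g \<Rightarrow> 'g \<Rightarrow> 'e) \<Rightarrow> 'g \<Rightarrow> 'g" where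
  "rp_f M \<phi> Z = (THE A. A \<in> carrier (xG M) \<and> bd M (\<phi> A Z) \<otimes>\<^bsub>xG M\<^esub> A = Z)"

definition rp_g :: "('e, 'g) xmod \<Rightarrow> ('g \<Rightarrow> 'g \<Rightarrow> 'e) \<Rightarrow> 'g \<Rightarrow> 'g" where
  "rp_g M \<psi> A = inv\<^bsub>xG M\<^esub> (bd M (\<psi> A A)) \<otimes>\<^bsub>xG M\<^esub> A"

locale framed_reidemeister_pair =
  fixes M :: "('e, 'g) xmod"
    and \<psi> \<phi> :: "'g \<Rightarrow> 'g \<Rightarrow> 'e"
  assumes psi_closed: "\<lbrakk>X \<in> carrier (xG M); Y \<in> carrier (xG M)\<rbrakk> \<Longrightarrow> \<psi> X Y \<in> carrier (xE M)"
    and phi_closed: "\<lbrakk>X \<in> carrier (xG M); Y \<in> carrier (xG M)\<rbrakk> \<Longrightarrow> \<phi> X Y \<in> carrier (xE M)"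
    and R2: "\<lbrakk>X \<in> carrier (xG M); Y \<in> carrier (xG M)\<rbrakk>
      \<Longrightarrow> \<phi> X Y \<otimes>\<^bsub>xE M\<^esub> \<psi> X (upper_neg M \<phi> X Y) = \<one>\<^bsub>xE M\<^esub>"
    and R3: "\<lbrakk>X \<in> carrier (xG M); Y \<in> carrier (xG M); T \<in> carrier (xG M);
        Z = upper_neg M \<phi> Y X; V = upper_neg M \<phi> T Y; W = upper_neg M \<phi> T X\<rbrakk>
      \<Longrightarrow> \<phi> Y X \<otimes>\<^bsub>xE M\<^esub> act M Y (\<phi> T Z) \<otimes>\<^bsub>xE M\<^esub> \<phi> T Y
        = act M X (\<phi> T Y) \<otimes>\<^bsub>xE M\<^esub> \<phi> T X \<otimes>\<^bsub>xE M\<^esub> act M T (\<phi> V W)"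
    and f_unique: "Z \<in> carrier (xG M)
      \<Longrightarrow> \<exists>!A. A \<in> carrier (xG M) \<and> bd M (\<phi> A Z) \<otimes>\<^bsub>xG M\<^esub> A = Z"
    and f_g: "A \<in> carrier (xG M) \<Longrightarrow> rp_f M \<phi> (rp_g M \<psi> A) = A"
    and g_f: "A \<in> carrier (xG M) \<Longrightarrow> rp_g M \<psi> (rp_f M \<phi> A) = A"

definition rack_psi :: "'a monoid \<Rightarrow> ('a \<Rightarrow> 'a \<Rightarrow> 'a) \<Rightarrow> 'a \<Rightarrow> 'a \<Rightarrow> 'a" where
  "rack_psi G lop b a = b \<otimes>\<^bsub>G\<^esub> a \<otimes>\<^bsub>G\<^esub> inv\<^bsub>G\<^esub> b \<otimes>\<^bsub>G\<^esub> inv\<^bsub>G\<^esub> (lop b a)"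

definition rack_phi :: "'a monoid \<Rightarrow> ('a \<Rightarrow> 'a \<Rightarrow> 'a) \<Rightarrow> 'a \<Rightarrow> 'a \<Rightarrow> 'a" where
  "rack_phi G rop b a = a \<otimes>\<^bsub>G\<^esub> b \<otimes>\<^bsub>G\<^esub> inv\<^bsub>G\<^esub> (rop a b) \<otimes>\<^bsub>G\<^esub> inv\<^bsub>G\<^esub> b"

type_synonym ('e, 'g) colouring = "(arc \<Rightarrow> 'g) \<times> (crossing \<Rightarrow> 'e)"

definition reidemeister_colourings ::
  "('e, 'g) xmod \<Rightarrow> ('g \<Rightarrow> 'g \<Rightarrow> 'e) \<Rightarrow> ('g \<Rightarrow> 'g \<Rightarrow> 'e) \<Rightarrow> diagram \<Rightarrow> ('e, 'g) colouring set" where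
  "reidemeister_colourings M \<psi> \<phi> D =
     {(c, w). c \<in> arcs D \<rightarrow>\<^sub>E carrier (xG M) \<and> w \<in> crossings D \<rightarrow>\<^sub>E carrier (xE M) \<and>
       (\<forall>k m. piece_at D k m XPos \<longrightarrow>
          w (k, m) = \<psi> (c (over D k m)) (c (lower D k m)) \<and>
          c (upper D k m) = upper_pos M \<psi> (c (over D k m)) (c (lower D k m))) \<and>
       (\<forall>k m. piece_at D k m XNeg \<longrightarrow>
          w (k, m) = \<phi> (c (over D k m)) (c (lower D k m)) \<and>
          c (upper D k m) = upper_neg M \<phi> (c (over D k m)) (c (lower D k m)))}"

fun signed :: "('e, 'g) xmod \<Rightarrow> orient \<Rightarrow> 'g \<Rightarrow> 'g" where
  "signed M Down X = X"
| "signed M Up X = inv\<^bsub>xG M\<^esub> X"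

text \<open>Only the source and the element of \<open>E\<close> are recorded for each piece. The two legs of a cup lie on
  the same arc, so they have the colour of its left end-point.\<close>

definition piece_mor ::
  "('e, 'g) xmod \<Rightarrow> diagram \<Rightarrow> ('e, 'g) colouring \<Rightarrow> nat \<Rightarrow> nat \<Rightarrow> ('e, 'g) morphism" where
  "piece_mor M D F k m =
     (let c = (\<lambda>p. fst F (arc_of D p)) in
      case D ! k ! m of
        Strand u \<Rightarrow> mor_id M (signed M u (c (tpt D k m 0)))
      | XPos \<Rightarrow> (fst F (upper D k m) \<otimes>\<^bsub>xG M\<^esub> fst F (over D k m), snd F (k, m))
      | XNeg \<Rightarrow> (fst F (over D k m) \<otimes>\<^bsub>xG M\<^esub> fst F (upper D k m), snd F (k, m))
      | Cup u \<Rightarrow> (signed M u (c (tpt D k m 0)) \<otimes>\<^bsub>xG M\<^esub> signed M (opp u) (c (tpt D k m 0)), \<one>\<^bsub>xE M\<^esub>)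
      | Cap u \<Rightarrow> (\<one>\<^bsub>xG M\<^esub>, \<one>\<^bsub>xE M\<^esub>))"

definition strip_mor ::
  "('e, 'g) xmod \<Rightarrow> diagram \<Rightarrow> ('e, 'g) colouring \<Rightarrow> nat \<Rightarrow> ('e, 'g) morphism" where
  "strip_mor M D F k =
     foldl (mor_tensor M) (mor_id M \<one>\<^bsub>xG M\<^esub>) (map (piece_mor M D F k) [0..<length (D ! k)])"

definition evaluation ::
  "('e, 'g) xmod \<Rightarrow> diagram \<Rightarrow> ('e, 'g) colouring \<Rightarrow> ('e, 'g) morphism" where
  "evaluation M D F =
     foldl (mor_comp M) (mor_id M \<one>\<^bsub>xG M\<^esub>) (map (strip_mor M D F) [0..<length D])"

text \<open>\<open>\<int>[A]\<close> for \<open>A = ker \<partial>\<close> is represented by the finitely supported integer-valued functions on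
  the type of elements of \<open>E\<close>, with \<open>frag_of a\<close> for the basis element \<open>a\<close>. The second component of
  the evaluation of a link diagram lies in \<open>A\<close>, because the evaluation is a morphism from \<open>1\<close> to
  \<open>1\<close>. The sum is finite if the underlying sets of \<open>G\<close> and \<open>E\<close> are.\<close>

definition state_sum ::
  "('e, 'g) xmod \<Rightarrow> ('g \<Rightarrow> 'g \<Rightarrow> 'e) \<Rightarrow> ('g \<Rightarrow> 'g \<Rightarrow> 'e) \<Rightarrow> diagram \<Rightarrow> 'e \<Rightarrow>\<^sub>0 int" where
  "state_sum M \<psi> \<phi> D =
     (\<Sum>F \<in> reidemeister_colourings M \<psi> \<phi> D. frag_of (snd (evaluation M D F)))"

end

theory Submission
  imports Defs
begin

text \<open>The element of \<open>E\<close> carried by a morphism of \<open>\<C>(\<G>)\<close> has boundary \<open>V U\<^sup>-\<^sup>1\<close>, so the evaluation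
  of any colouring of a link diagram, being a morphism from \<open>1\<close> to \<open>1\<close>, lies in \<open>ker \<partial>\<close>. For the
  crossed module \<open>(id, ad)\<close> this kernel is trivial, so that each colouring contributes \<open>1\<^sub>G\<close> to the state
  sum. The pair \<open>(\<psi>, \<phi>)\<close> is chosen so that the crossing relations become \<open>Z = X \<triangleright> Y\<close> and
  \<open>Z = Y \<triangleleft> X\<close>; hence forgetting the colours of the crossings is a bijection onto the rack
  colourings.\<close>

section \<open>Cancellation of inverses in group words\<close>

lemma (in group) inv_mult_cancel_left:
  "\<lbrakk>x \<in> carrier G; y \<in> carrier G\<rbrakk> \<Longrightarrow> inv x \<otimes> (x \<otimes> y) = y"
  by (simp add: m_assoc[symmetric])

lemma (in group) mult_inv_cancel_left:
  "\<lbrakk>x \<in> carrier G; y \<in> carrier G\<rbrakk> \<Longrightarrow> x \<otimes> (inv x \<otimes> y) = y"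
  by (simp add: m_assoc[symmetric])

text \<open>Words are brought to right-nested form, where neighbouring inverse pairs cancel. The
  group stays a parameter, so that the rules apply to \<open>xG M\<close>.\<close>

lemmas group_normalise = group.inv_mult_cancel_left group.mult_inv_cancel_left
  group.inv_mult_group monoid.m_assoc

section \<open>The two diagonal maps of a rack\<close>

context rack
begin

text \<open>With \<open>B = A \<triangleright> A\<close> one has
  \<open>B \<triangleleft> A = A\<close>, so self-distributivity gives \<open>(B \<triangleleft> B)
  \<triangleleft> A = A \<triangleleft> A\<close>, and right translation by \<open>A\<close> is
  injective. Together with its mirror image below, this makes the diagonal maps mutually inverse;
  they turn out to be the maps g and f of the framed pair.\<close>

lemma diag_rop_lop: "A \<in> R \<Longrightarrow> (A \<triangleright> A) \<triangleleft> (A \<triangleright> A) = A"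
  by (metis lop_closed lop_rop rop_closed rop_distrib rop_lop)

lemma diag_lop_rop: "Z \<in> R \<Longrightarrow> (Z \<triangleleft> Z) \<triangleright> (Z \<triangleleft> Z) = Z"
  by (metis lop_closed lop_distrib lop_rop rop_closed rop_lop)

text \<open>\<open>Z \<triangleleft> A = A\<close> means \<open>Z = A \<triangleright> A\<close>,
  and the diagonal maps are mutually inverse. This solves the equation that defines f.\<close>

lemma rop_fixpoint_iff:
  assumes "A \<in> R" "Z \<in> R"
  shows "Z \<triangleleft> A = A \<longleftrightarrow> A = Z \<triangleleft> Z"
  by (metis assms diag_lop_rop diag_rop_lop lop_rop rop_closed rop_lop)

end

lemma crossed_module_conj_xmod:
  assumes "group G"
  shows "crossed_module (conj_xmod G)"
proof -
  interpret group G by fact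
  show ?thesis
    by unfold_locales (auto simp: conj_xmod_def hom_def m_assoc inv_mult_group inv_mult_cancel_left)
qed

text \<open>For infinite \<open>A\<close> both sides are zero by the default values of the sum and
  of \<open>card\<close>.\<close>

lemma sum_frag_const: "(\<Sum>x \<in> A. c) = frag_cmul (int (card A)) c"
  by (induction A rule: infinite_finite_induct) (simp_all add: frag_cmul_distrib)

section \<open>Points, arcs and horizontal lines of a diagram\<close>

lemma tpt_in_points:
  assumes "piece_at D k m p" "i < length (piece_top p)"
  shows "tpt D k m i \<in> points D"
proof -
  \<comment> \<open>Cutting the strip at the piece shows that the offset counts only end-points to
    its left, which leaves room for its own.\<close>
  have "D ! k = take m (D ! k) @ p # drop (Suc m) (D ! k)"
    using assms(1) id_take_nth_drop unfolding piece_at_def by blast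
  then have "length (strip_top (D ! k)) = length (strip_top (take m (D ! k) @ p # drop (Suc m) (D ! k)))"
    by simp
  then show ?thesis
    using assms by (simp add: tpt_def points_def strip_top_def piece_at_def)
qed

lemma bpt_in_points:
  assumes "piece_at D k m p" "i < length (piece_bot p)"
  shows "bpt D k m i \<in> points D"
proof -
  have "D ! k = take m (D ! k) @ p # drop (Suc m) (D ! k)"
    using assms(1) id_take_nth_drop unfolding piece_at_def by blast
  then have "length (strip_bot (D ! k)) = length (strip_bot (take m (D ! k) @ p # drop (Suc m) (D ! k)))"
    by simp
  then show ?thesis
    using assms by (simp add: bpt_def points_def strip_bot_def piece_at_def)
qed

lemma crossing_arcs:
  assumes "piece_at D k m XPos \<or> piece_at D k m XNeg"
  shows "over D k m \<in> arcs D" "lower D k m \<in> arcs D" "upper D k m \<in> arcs D"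
  using assms
  by (auto simp: over_def lower_def upper_def arcs_def intro!: imageI
      intro: tpt_in_points[where p = XPos] tpt_in_points[where p = XNeg]
        bpt_in_points[where p = XPos] bpt_in_points[where p = XNeg])

lemma arc_of_eq:
  assumes "linked D p q"
  shows "arc_of D p = arc_of D q"
proof -
  have "equivclp (linked D) p q"
    using assms by (rule r_into_equivclp)
  then show ?thesis
    unfolding arc_of_def by (blast intro: equivclp_trans equivclp_sym)
qed

text \<open>The orientations along horizontal line number \<open>n\<close> of a tangle whose top boundary is \<open>a\<close>.\<close>

fun level :: "orient list \<Rightarrow> diagram \<Rightarrow> nat \<Rightarrow> orient list" where
  "level a D 0 = a"
| "level a D (Suc k) = strip_bot (D ! k)"

text \<open>Recasts the recursive gluing condition line by line, so that consecutive strip morphisms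
  can be matched by index.\<close>

lemma tangle_level:
  assumes "tangle a D b"
  shows "(\<forall>k < length D. strip_top (D ! k) = level a D k) \<and> level a D (length D) = b"
  using assms
proof (induction a D b rule: tangle.induct)
  case (2 a s D b)
  \<comment> \<open>Removing the first strip lowers every line number by one, and the bottom of that
    strip becomes the new top line.\<close>
  have shift: "level c (s # D) (Suc k) = level (strip_bot s) D k" for c k
    by (cases k) auto
  show ?case
    using 2 by (auto simp: shift less_Suc_eq_0_disj simp del: level.simps(2))
qed simp

lemma reidemeister_colouringsD:
  assumes "F \<in> reidemeister_colourings M \<psi> \<phi> D"
  shows "x \<in> arcs D \<Longrightarrow> fst F x \<in> carrier (xG M)"
    and "y \<in> crossings D \<Longrightarrow> snd F y \<in> carrier (xE M)"
    and "piece_at D k m XPos \<Longrightarrow> snd F (k, m) = \<psi> (fst F (over D k m)) (fst F (lower D k m))"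
    and "piece_at D k m XPos \<Longrightarrow>
      fst F (upper D k m) = upper_pos M \<psi> (fst F (over D k m)) (fst F (lower D k m))"
    and "piece_at D k m XNeg \<Longrightarrow> snd F (k, m) = \<phi> (fst F (over D k m)) (fst F (lower D k m))"
    and "piece_at D k m XNeg \<Longrightarrow>
      fst F (upper D k m) = upper_neg M \<phi> (fst F (over D k m)) (fst F (lower D k m))"
  using assms by (auto simp: reidemeister_colourings_def)

section \<open>The evaluation as an endomorphism of the unit object\<close>

context crossed_module
begin

interpretation E: group "xE M" by (rule group_E)
interpretation G: group "xG M" by (rule group_G)
interpretation bd: group_hom "xE M" "xG M" "bd M"
  by (simp add: group_hom_def group_hom_axioms_def group_E group_G bd_hom)

text \<open>Composition and tensor product are total on pairs, so sources and targets are tracked by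
  a separate predicate.\<close>

definition is_mor :: "('e, 'g) morphism \<Rightarrow> 'g \<Rightarrow> 'g \<Rightarrow> bool" where
  "is_mor f U V \<longleftrightarrow> U \<in> carrier (xG M) \<and> fst f = U \<and> snd f \<in> carrier (xE M) \<and> mor_target M f = V"

lemma is_mor_id: "U \<in> carrier (xG M) \<Longrightarrow> is_mor (mor_id M U) U U"
  by (simp add: is_mor_def mor_id_def mor_target_def)

lemma is_mor_comp: "\<lbrakk>is_mor f U V; is_mor g V W\<rbrakk> \<Longrightarrow> is_mor (mor_comp M f g) U W"
  by (auto simp: is_mor_def mor_comp_def mor_target_def G.m_assoc)

text \<open>The acted-on factor has boundary \<open>V (\<partial> g) V\<^sup>-\<^sup>1\<close>;
  since \<open>(\<partial> f) U = V\<close>, the inverse cancels and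
  \<open>V (\<partial> g) W = V X\<close> remains.\<close>

lemma is_mor_tensor:
  assumes "is_mor f U V" "is_mor g W X"
  shows "is_mor (mor_tensor M f g) (U \<otimes>\<^bsub>xG M\<^esub> W) (V \<otimes>\<^bsub>xG M\<^esub> X)"
proof -
  have "mor_target M (mor_tensor M f g)
    = bd M (act M V (snd g) \<otimes>\<^bsub>xE M\<^esub> snd f) \<otimes>\<^bsub>xG M\<^esub> (U \<otimes>\<^bsub>xG M\<^esub> W)"
    \<comment> \<open>Only the target of the explicit pair is unfolded;
      \<open>mor_target M f\<close> stays folded so that it rewrites to \<open>V\<close>.\<close>
    using assms by (simp add: is_mor_def mor_tensor_def mor_target_def[of M "(_, _)"])
  moreover have "V \<in> carrier (xG M)" "snd f \<in> carrier (xE M)" "snd g \<in> carrier (xE M)"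
    "U \<in> carrier (xG M)" "W \<in> carrier (xG M)" "V = bd M (snd f) \<otimes>\<^bsub>xG M\<^esub> U"
    "X = bd M (snd g) \<otimes>\<^bsub>xG M\<^esub> W"
    using assms by (auto simp: is_mor_def mor_target_def)
  moreover from this have "inv\<^bsub>xG M\<^esub> V \<otimes>\<^bsub>xG M\<^esub> (bd M (snd f) \<otimes>\<^bsub>xG M\<^esub> (U \<otimes>\<^bsub>xG M\<^esub> W)) = W"
    by (metis G.inv_mult_cancel_left G.m_assoc bd.hom_closed)
  ultimately have "mor_target M (mor_tensor M f g) = V \<otimes>\<^bsub>xG M\<^esub> X"
    by (simp add: act_closed bd_act G.m_assoc)
  then show ?thesis
    using assms by (auto simp: is_mor_def mor_tensor_def act_closed mor_target_def)
qed

lemma signed_closed: "x \<in> carrier (xG M) \<Longrightarrow> signed M u x \<in> carrier (xG M)"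
  by (cases u) auto

lemma signed_opp: "x \<in> carrier (xG M) \<Longrightarrow> signed M u x \<otimes>\<^bsub>xG M\<^esub> signed M (opp u) x = \<one>\<^bsub>xG M\<^esub>"
  by (cases u) auto

text \<open>The object of the category read off along horizontal line \<open>k\<close>, for a segment of consecutive
  points starting at \<open>(k, j)\<close>.\<close>

fun obj :: "(point \<Rightarrow> 'g) \<Rightarrow> nat \<Rightarrow> nat \<Rightarrow> orient list \<Rightarrow> 'g" where
  "obj c k j [] = \<one>\<^bsub>xG M\<^esub>"
| "obj c k j (u # us) = signed M u (c (k, j)) \<otimes>\<^bsub>xG M\<^esub> obj c k (Suc j) us"

lemma obj_closed:
  "(\<And>i. i < length us \<Longrightarrow> c (k, j + i) \<in> carrier (xG M)) \<Longrightarrow> obj c k j us \<in> carrier (xG M)"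
proof (induction us arbitrary: j)
  case (Cons u us)
  have "c (k, j) \<in> carrier (xG M)"
    using Cons.prems[of 0] by simp
  moreover have "obj c k (Suc j) us \<in> carrier (xG M)"
    using Cons.prems[of "Suc _"] by (intro Cons.IH) auto
  ultimately show ?case
    by (simp add: signed_closed)
qed simp

text \<open>Juxtaposed segments correspond to tensor products of objects; the shift by
  \<open>length us\<close> is the kind of offset built into \<open>tpt\<close> and
  \<open>bpt\<close>.\<close>

lemma obj_append:
  "(\<And>i. i < length (us @ vs) \<Longrightarrow> c (k, j + i) \<in> carrier (xG M)) \<Longrightarrow>
    obj c k j (us @ vs) = obj c k j us \<otimes>\<^bsub>xG M\<^esub> obj c k (j + length us) vs"
proof (induction us arbitrary: j)
  case Nil
  then show ?case
    by (simp add: obj_closed)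
next
  case (Cons u us)
  have cl: "c (k, Suc j + i) \<in> carrier (xG M)" if "i < length (us @ vs)" for i
    using Cons.prems[of "Suc i"] that by simp
  have "c (k, j) \<in> carrier (xG M)"
    using Cons.prems[of 0] by simp
  moreover have "obj c k (Suc j) us \<in> carrier (xG M)"
    by (rule obj_closed) (use cl in auto)
  moreover have "obj c k (Suc j + length us) vs \<in> carrier (xG M)"
    by (rule obj_closed) (use cl[of "length us + _"] in \<open>auto simp: add.assoc\<close>)
  ultimately show ?case
    using Cons.IH[of "Suc j"] cl by (simp add: signed_closed G.m_assoc)
qed

text \<open>The colour of the upper arc is \<open>(\<partial> \<psi>) Z X = X Y\<close> solved for
  \<open>Z\<close>.\<close>

lemma is_mor_pos:
  assumes "X \<in> carrier (xG M)" "Y \<in> carrier (xG M)" "\<psi> X Y \<in> carrier (xE M)"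
  shows "is_mor (upper_pos M \<psi> X Y \<otimes>\<^bsub>xG M\<^esub> X, \<psi> X Y) (upper_pos M \<psi> X Y \<otimes>\<^bsub>xG M\<^esub> X) (X \<otimes>\<^bsub>xG M\<^esub> Y)"
  using assms by (simp add: is_mor_def mor_target_def upper_pos_def group_normalise group_G G.is_monoid)

text \<open>The colour of the upper arc is \<open>(\<partial> \<phi>) X Z = Y X\<close> solved for
  \<open>Z\<close>.\<close>

lemma is_mor_neg:
  assumes "X \<in> carrier (xG M)" "Y \<in> carrier (xG M)" "\<phi> X Y \<in> carrier (xE M)"
  shows "is_mor (X \<otimes>\<^bsub>xG M\<^esub> upper_neg M \<phi> X Y, \<phi> X Y) (X \<otimes>\<^bsub>xG M\<^esub> upper_neg M \<phi> X Y) (Y \<otimes>\<^bsub>xG M\<^esub> X)"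
  using assms by (simp add: is_mor_def mor_target_def upper_neg_def group_normalise group_G G.is_monoid)

text \<open>Colours agree at both ends of a strand, the legs of a cup or cap contribute inverse
  factors, and the crossing relations are boundary conditions.\<close>

lemma is_mor_piece:
  assumes F: "F \<in> reidemeister_colourings M \<psi> \<phi> D"
    and p: "piece_at D k m p"
    and c_def: "c = (\<lambda>q. fst F (arc_of D q))"
  shows "is_mor (piece_mor M D F k m)
    (obj c k (length (strip_top (take m (D ! k)))) (piece_top p))
    (obj c (Suc k) (length (strip_bot (take m (D ! k)))) (piece_bot p))"
proof -
  have nth: "D ! k ! m = p"
    using p by (simp add: piece_at_def)
  have top: "c (tpt D k m i) \<in> carrier (xG M)" if "i < length (piece_top p)" for i
    using reidemeister_colouringsD(1)[OF F] tpt_in_points[OF p that] by (simp add: c_def arcs_def)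
  have bot: "c (bpt D k m i) \<in> carrier (xG M)" if "i < length (piece_bot p)" for i
    using reidemeister_colouringsD(1)[OF F] bpt_in_points[OF p that] by (simp add: c_def arcs_def)
  \<comment> \<open>A piece has at most two end-points on each side. For these lengths
    \<open>obj\<close> is expressed through \<open>tpt\<close>, and the trailing unit of its
    recursion disappears.\<close>
  have pt: "obj c k (length (strip_top (take m (D ! k)))) [] = \<one>\<^bsub>xG M\<^esub>"
    "\<And>u. c (tpt D k m 0) \<in> carrier (xG M) \<Longrightarrow>
      obj c k (length (strip_top (take m (D ! k)))) [u] = signed M u (c (tpt D k m 0))"
    "\<And>u v. \<lbrakk>c (tpt D k m 0) \<in> carrier (xG M); c (tpt D k m 1) \<in> carrier (xG M)\<rbrakk> \<Longrightarrow>
      obj c k (length (strip_top (take m (D ! k)))) [u, v]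
        = signed M u (c (tpt D k m 0)) \<otimes>\<^bsub>xG M\<^esub> signed M v (c (tpt D k m 1))"
    by (simp_all add: tpt_def signed_closed)
  have pb: "obj c (Suc k) (length (strip_bot (take m (D ! k)))) [] = \<one>\<^bsub>xG M\<^esub>"
    "\<And>u. c (bpt D k m 0) \<in> carrier (xG M) \<Longrightarrow>
      obj c (Suc k) (length (strip_bot (take m (D ! k)))) [u] = signed M u (c (bpt D k m 0))"
    "\<And>u v. \<lbrakk>c (bpt D k m 0) \<in> carrier (xG M); c (bpt D k m 1) \<in> carrier (xG M)\<rbrakk> \<Longrightarrow>
      obj c (Suc k) (length (strip_bot (take m (D ! k)))) [u, v]
        = signed M u (c (bpt D k m 0)) \<otimes>\<^bsub>xG M\<^esub> signed M v (c (bpt D k m 1))"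
    by (simp_all add: bpt_def signed_closed)
  have link: "c q = c r" if "linked D q r" for q r
    using arc_of_eq[OF that] by (simp add: c_def)
  show ?thesis
  proof (cases p)
    case (Strand u)
    have "c (tpt D k m 0) = c (bpt D k m 0)"
      using p Strand by (intro link linked.intros(1)) simp
    moreover have "piece_mor M D F k m = mor_id M (signed M u (c (tpt D k m 0)))"
      using Strand by (simp add: piece_mor_def nth c_def)
    ultimately show ?thesis
      using Strand top[of 0] bot[of 0] pt(2)[of u] pb(2)[of u] is_mor_id
      by (simp add: signed_closed del: obj.simps)
  next
    case XPos
    note p' = p[unfolded XPos]
    have l: "c (tpt D k m 1) = c (bpt D k m 0)"
      using p' by (intro link linked.intros(2))
    \<comment> \<open>The over-arc is defined at the top right; the link moves it to the bottom
      left, so that the bottom line reads over-arc times lower arc.\<close>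
    have arcs: "fst F (over D k m) = c (bpt D k m 0)" "fst F (lower D k m) = c (bpt D k m 1)"
      "fst F (upper D k m) = c (tpt D k m 0)"
      using p' l by (simp_all add: c_def over_def lower_def upper_def)
    have "snd F (k, m) \<in> carrier (xE M)" "snd F (k, m) = \<psi> (c (bpt D k m 0)) (c (bpt D k m 1))"
      "c (tpt D k m 0) = upper_pos M \<psi> (c (bpt D k m 0)) (c (bpt D k m 1))"
      using reidemeister_colouringsD(2)[OF F, of "(k, m)"] p'
        reidemeister_colouringsD(3,4)[OF F p'] by (simp_all add: crossings_def arcs)
    then show ?thesis
      using XPos top[of 0] top[of 1] bot[of 0] bot[of 1] l
        is_mor_pos[of "c (bpt D k m 0)" "c (bpt D k m 1)" \<psi>]
      by (simp add: piece_mor_def nth pt pb arcs del: obj.simps flip: One_nat_def)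
  next
    case XNeg
    note p' = p[unfolded XNeg]
    \<comment> \<open>\<open>over\<close>, \<open>lower\<close> and \<open>upper\<close> test for
      \<open>XPos\<close>, so this selects their other branch.\<close>
    have np: "\<not> piece_at D k m XPos"
      using p' by (simp add: piece_at_def)
    have l: "c (tpt D k m 0) = c (bpt D k m 1)"
      using p' by (intro link linked.intros(3))
    have arcs: "fst F (over D k m) = c (bpt D k m 1)" "fst F (lower D k m) = c (bpt D k m 0)"
      "fst F (upper D k m) = c (tpt D k m 1)"
      using np l by (simp_all add: c_def over_def lower_def upper_def)
    have "snd F (k, m) \<in> carrier (xE M)" "snd F (k, m) = \<phi> (c (bpt D k m 1)) (c (bpt D k m 0))"
      "c (tpt D k m 1) = upper_neg M \<phi> (c (bpt D k m 1)) (c (bpt D k m 0))"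
      using reidemeister_colouringsD(2)[OF F, of "(k, m)"] p'
        reidemeister_colouringsD(5,6)[OF F p'] by (simp_all add: crossings_def arcs)
    then show ?thesis
      using XNeg top[of 0] top[of 1] bot[of 0] bot[of 1] l
        is_mor_neg[of "c (bpt D k m 1)" "c (bpt D k m 0)" \<phi>]
      by (simp add: piece_mor_def nth pt pb arcs del: obj.simps flip: One_nat_def)
  next
    case (Cup u)
    have "c (tpt D k m 0) = c (tpt D k m 1)"
      using p Cup by (intro link linked.intros(4)) simp
    moreover have "piece_mor M D F k m = (signed M u (c (tpt D k m 0)) \<otimes>\<^bsub>xG M\<^esub>
        signed M (opp u) (c (tpt D k m 0)), \<one>\<^bsub>xE M\<^esub>)"
      using Cup by (simp add: piece_mor_def nth c_def)
    ultimately show ?thesis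
      using Cup top[of 0] top[of 1] is_mor_id[of "\<one>\<^bsub>xG M\<^esub>"]
      by (simp add: pt pb signed_opp mor_id_def del: obj.simps flip: One_nat_def)
  next
    case (Cap u)
    have "c (bpt D k m 0) = c (bpt D k m 1)"
      using p Cap by (intro link linked.intros(5)) simp
    then show ?thesis
      using Cap bot[of 0] bot[of 1] is_mor_id[of "\<one>\<^bsub>xG M\<^esub>"]
      by (simp add: piece_mor_def nth pt pb signed_opp mor_id_def del: obj.simps flip: One_nat_def)
  qed
qed

lemma is_mor_strip:
  assumes F: "F \<in> reidemeister_colourings M \<psi> \<phi> D"
    and k: "k < length D"
    and c_def: "c = (\<lambda>q. fst F (arc_of D q))"
  shows "is_mor (strip_mor M D F k) (obj c k 0 (strip_top (D ! k))) (obj c (Suc k) 0 (strip_bot (D ! k)))"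
proof -
  have c: "c q \<in> carrier (xG M)" if "q \<in> points D" for q
    using reidemeister_colouringsD(1)[OF F] that by (simp add: c_def arcs_def)
  \<comment> \<open>\<open>strip_mor\<close> is a left fold, so the induction runs over initial
    segments of the strip.\<close>
  have "is_mor (foldl (mor_tensor M) (mor_id M \<one>\<^bsub>xG M\<^esub>) (map (piece_mor M D F k) [0..<n]))
    (obj c k 0 (strip_top (take n (D ! k)))) (obj c (Suc k) 0 (strip_bot (take n (D ! k))))"
    if "n \<le> length (D ! k)" for n
    using that
  proof (induction n)
    case 0
    then show ?case
      by (simp add: strip_top_def strip_bot_def is_mor_id)
  next
    case (Suc n)
    define p where "p = D ! k ! n"
    have p: "piece_at D k n p"
      using Suc.prems k by (simp add: piece_at_def p_def)
    \<comment> \<open>This decomposition bounds the number of end-points of the segment by that of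
      the whole strip, so all of them are coloured points.\<close>
    have split: "D ! k = take n (D ! k) @ p # drop (Suc n) (D ! k)"
      using Suc.prems by (simp add: p_def id_take_nth_drop)
    have tk: "take (Suc n) (D ! k) = take n (D ! k) @ [p]"
      using Suc.prems by (simp add: p_def take_Suc_conv_app_nth)
    have st: "strip_top (take (Suc n) (D ! k)) = strip_top (take n (D ! k)) @ piece_top p"
      and sb: "strip_bot (take (Suc n) (D ! k)) = strip_bot (take n (D ! k)) @ piece_bot p"
      by (simp_all add: tk strip_top_def strip_bot_def)
    have "c (k, 0 + i) \<in> carrier (xG M)" if "i < length (strip_top (take n (D ! k)) @ piece_top p)" for i
      using that k arg_cong[OF split, of "\<lambda>s. length (strip_top s)"]
      by (intro c) (simp add: points_def strip_top_def)
    then have "obj c k 0 (strip_top (take (Suc n) (D ! k)))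
      = obj c k 0 (strip_top (take n (D ! k))) \<otimes>\<^bsub>xG M\<^esub>
        obj c k (length (strip_top (take n (D ! k)))) (piece_top p)"
      unfolding st by (subst obj_append) auto
    moreover have "c (Suc k, 0 + i) \<in> carrier (xG M)"
      if "i < length (strip_bot (take n (D ! k)) @ piece_bot p)" for i
      using that k arg_cong[OF split, of "\<lambda>s. length (strip_bot s)"]
      by (intro c) (simp add: points_def strip_bot_def)
    then have "obj c (Suc k) 0 (strip_bot (take (Suc n) (D ! k)))
      = obj c (Suc k) 0 (strip_bot (take n (D ! k))) \<otimes>\<^bsub>xG M\<^esub>
        obj c (Suc k) (length (strip_bot (take n (D ! k)))) (piece_bot p)"
      unfolding sb by (subst obj_append) auto
    ultimately show ?case
      using is_mor_tensor[OF Suc.IH is_mor_piece[OF F p c_def]] Suc.prems by simp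
  qed
  from this[of "length (D ! k)"] show ?thesis
    by (simp add: strip_mor_def)
qed

text \<open>The first \<open>n\<close> strips compose to a morphism from the unit to the object
  along line \<open>n\<close>. The last line is empty, and its object is again the unit.\<close>

lemma is_mor_evaluation:
  assumes F: "F \<in> reidemeister_colourings M \<psi> \<phi> D"
    and D: "link_diagram D"
  shows "is_mor (evaluation M D F) \<one>\<^bsub>xG M\<^esub> \<one>\<^bsub>xG M\<^esub>"
proof -
  define c where "c = (\<lambda>q. fst F (arc_of D q))"
  have lev: "\<forall>k < length D. strip_top (D ! k) = level [] D k" "level [] D (length D) = []"
    using tangle_level[of "[]" D "[]"] D by (simp_all add: link_diagram_def)
  have "is_mor (foldl (mor_comp M) (mor_id M \<one>\<^bsub>xG M\<^esub>) (map (strip_mor M D F) [0..<n]))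
    \<one>\<^bsub>xG M\<^esub> (obj c n 0 (level [] D n))" if "n \<le> length D" for n
    using that
  proof (induction n)
    case (Suc n)
    then show ?case
      using is_mor_comp[OF Suc.IH] is_mor_strip[OF F _ c_def, of n] lev(1) by simp
  qed (simp add: is_mor_id)
  from this[of "length D"] lev(2) show ?thesis
    by (simp add: evaluation_def)
qed

lemma bd_evaluation:
  assumes "F \<in> reidemeister_colourings M \<psi> \<phi> D" "link_diagram D"
  shows "bd M (snd (evaluation M D F)) = \<one>\<^bsub>xG M\<^esub>"
  using is_mor_evaluation[OF assms] by (auto simp: is_mor_def mor_target_def)

end

section \<open>The framed Reidemeister pair of a rack on the underlying set of a group\<close>

locale group_rack = group G + rack "carrier G" lop rop
  for G :: "'a monoid" (structure) and lop (infix "\<triangleright>" 70) and rop (infix "\<triangleleft>" 70)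
begin

lemmas closed [simp] = lop_closed rop_closed
lemmas normalise = m_assoc inv_mult_group inv_mult_cancel_left mult_inv_cancel_left

text \<open>\<open>rack_psi\<close> is the quotient of conjugation by the rack operation, so
  multiplying by its inverse replaces \<open>x y x\<^sup>-\<^sup>1\<close> by
  \<open>x \<triangleright> y\<close>.\<close>

lemma upper_pos_rack:
  "\<lbrakk>x \<in> carrier G; y \<in> carrier G\<rbrakk> \<Longrightarrow> upper_pos (conj_xmod G) (rack_psi G lop) x y = x \<triangleright> y"
  by (simp add: upper_pos_def rack_psi_def conj_xmod_def normalise)

lemma upper_neg_rack:
  "\<lbrakk>x \<in> carrier G; y \<in> carrier G\<rbrakk> \<Longrightarrow> upper_neg (conj_xmod G) (rack_phi G rop) x y = y \<triangleleft> x"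
  by (simp add: upper_neg_def rack_phi_def conj_xmod_def normalise)

text \<open>The left-hand side telescopes to
  \<open>Z A (Z \<triangleleft> A)\<^sup>-\<^sup>1\<close>, which is \<open>Z\<close> exactly when
  \<open>Z \<triangleleft> A = A\<close>. Condition (i) of a framed pair follows, with the diagonal
  as the solution.\<close>

lemma phi_fixpoint_iff:
  assumes "A \<in> carrier G" "Z \<in> carrier G"
  shows "rack_phi G rop A Z \<otimes> A = Z \<longleftrightarrow> A = Z \<triangleleft> Z"
proof -
  have "rack_phi G rop A Z \<otimes> A = Z \<otimes> (A \<otimes> inv (Z \<triangleleft> A))"
    using assms by (simp add: rack_phi_def normalise)
  also have "\<dots> = Z \<longleftrightarrow> A \<otimes> inv (Z \<triangleleft> A) = \<one>"
    using assms by (simp add: l_cancel_one)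
  also have "\<dots> \<longleftrightarrow> Z \<triangleleft> A = A"
    using assms by (metis closed(2) inv_closed inv_equality inv_inv r_inv)
  finally show ?thesis
    using assms by (simp add: rop_fixpoint_iff)
qed

lemma rp_f_rack: "Z \<in> carrier G \<Longrightarrow> rp_f (conj_xmod G) (rack_phi G rop) Z = Z \<triangleleft> Z"
  by (auto simp: rp_f_def conj_xmod_def phi_fixpoint_iff intro!: the_equality)

lemma rp_g_rack: "A \<in> carrier G \<Longrightarrow> rp_g (conj_xmod G) (rack_psi G lop) A = A \<triangleright> A"
  by (simp add: rp_g_def rack_psi_def conj_xmod_def normalise)

lemma framed_reidemeister_pair_rack:
  "framed_reidemeister_pair (conj_xmod G) (rack_psi G lop) (rack_phi G rop)"
proof
  let ?M = "conj_xmod G" and ?\<psi> = "rack_psi G lop" and ?\<phi> = "rack_phi G rop"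
  have car: "carrier (xG ?M) = carrier G" "carrier (xE ?M) = carrier G"
    by (simp_all add: conj_xmod_def)
  show "?\<psi> X Y \<in> carrier (xE ?M)" "?\<phi> X Y \<in> carrier (xE ?M)"
    "?\<phi> X Y \<otimes>\<^bsub>xE ?M\<^esub> ?\<psi> X (upper_neg ?M ?\<phi> X Y) = \<one>\<^bsub>xE ?M\<^esub>"
    if "X \<in> carrier (xG ?M)" "Y \<in> carrier (xG ?M)" for X Y
    using that unfolding car
    \<comment> \<open>\<open>upper_neg_rack\<close> has to act before \<open>conj_xmod\<close> is
      unfolded. In (R2) the word then collapses to
      \<open>Y (X \<triangleright> (Y \<triangleleft> X))\<^sup>-\<^sup>1\<close>.\<close>
    by (simp_all add: upper_neg_rack) (simp_all add: conj_xmod_def rack_psi_def rack_phi_def normalise lop_rop)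
  show "?\<phi> Y X \<otimes>\<^bsub>xE ?M\<^esub> act ?M Y (?\<phi> T Z) \<otimes>\<^bsub>xE ?M\<^esub> ?\<phi> T Y
        = act ?M X (?\<phi> T Y) \<otimes>\<^bsub>xE ?M\<^esub> ?\<phi> T X \<otimes>\<^bsub>xE ?M\<^esub> act ?M T (?\<phi> V W)"
    if "X \<in> carrier (xG ?M)" "Y \<in> carrier (xG ?M)" "T \<in> carrier (xG ?M)"
      "Z = upper_neg ?M ?\<phi> Y X" "V = upper_neg ?M ?\<phi> T Y" "W = upper_neg ?M ?\<phi> T X"
    for X Y T Z V W
  proof -
    have [simp]: "X \<in> carrier G" "Y \<in> carrier G" "T \<in> carrier G"
      "Z = X \<triangleleft> Y" "V = Y \<triangleleft> T" "W = X \<triangleleft> T"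
      using that by (simp_all add: car upper_neg_rack)
    show ?thesis
      \<comment> \<open>The left side telescopes to \<open>X Y T ((X \<triangleleft> Y)
        \<triangleleft> T)\<^sup>-\<^sup>1 (Y \<triangleleft> T)\<^sup>-\<^sup>1
        T\<^sup>-\<^sup>1\<close>; the right side is the same word with
        \<open>(X \<triangleleft> T) \<triangleleft> (Y \<triangleleft> T)\<close> in the first
        inverse.\<close>
      by (simp add: conj_xmod_def rack_phi_def normalise rop_distrib[of X Y T])
  qed
  show "\<exists>!A. A \<in> carrier (xG ?M) \<and> bd ?M (?\<phi> A Z) \<otimes>\<^bsub>xG ?M\<^esub> A = Z" if "Z \<in> carrier (xG ?M)" for Z
    using that by (intro ex1I[of _ "Z \<triangleleft> Z"]) (auto simp: conj_xmod_def phi_fixpoint_iff)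
  show "rp_f ?M ?\<phi> (rp_g ?M ?\<psi> A) = A" "rp_g ?M ?\<psi> (rp_f ?M ?\<phi> A) = A"
    if "A \<in> carrier (xG ?M)" for A
    using that unfolding car by (simp_all add: rp_f_rack rp_g_rack diag_rop_lop diag_lop_rop)
qed

section \<open>Counting colourings and computing the state sum\<close>

lemma bij_betw_colourings:
  "bij_betw fst (reidemeister_colourings (conj_xmod G) (rack_psi G lop) (rack_phi G rop) D)
    (rack_colourings (carrier G) lop rop D)"
proof (rule bij_betw_imageI)
  let ?M = "conj_xmod G" and ?\<psi> = "rack_psi G lop" and ?\<phi> = "rack_phi G rop"
  let ?C = "reidemeister_colourings ?M ?\<psi> ?\<phi> D"
  have car: "carrier (xG ?M) = carrier G" "carrier (xE ?M) = carrier G"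
    by (simp_all add: conj_xmod_def)
  have in_G: "c (over D k m) \<in> carrier G" "c (lower D k m) \<in> carrier G"
    if "c \<in> arcs D \<rightarrow>\<^sub>E carrier G" "piece_at D k m XPos \<or> piece_at D k m XNeg" for c k m
    using crossing_arcs[OF that(2)] that(1) by auto
  show "inj_on fst ?C"
  proof (rule inj_onI)
    fix F F' assume F: "F \<in> ?C" "F' \<in> ?C" and eq: "fst F = fst F'"
    have "snd F x = snd F' x" if "x \<in> crossings D" for x
      using F[THEN reidemeister_colouringsD(3)] F[THEN reidemeister_colouringsD(5)] eq that
      by (cases x) (auto simp: crossings_def)
    \<comment> \<open>Crossing labels are extensional, so agreement on the crossings makes them
      equal as functions.\<close>
    moreover have "snd F \<in> extensional (crossings D)" "snd F' \<in> extensional (crossings D)"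
      using F unfolding reidemeister_colourings_def by (auto simp: PiE_def)
    ultimately have "snd F = snd F'"
      by (intro extensionalityI)
    then show "F = F'"
      using eq by (simp add: prod_eq_iff)
  qed
  show "fst ` ?C = rack_colourings (carrier G) lop rop D"
  proof (intro equalityI subsetI)
    fix c assume "c \<in> fst ` ?C"
    then show "c \<in> rack_colourings (carrier G) lop rop D"
      using in_G[of c] unfolding reidemeister_colourings_def rack_colourings_def car
      by (auto simp: upper_pos_rack upper_neg_rack)
  next
    fix c assume c: "c \<in> rack_colourings (carrier G) lop rop D"
    \<comment> \<open>The relations force these labels; \<open>restrict\<close> supplies the default
      value outside the crossings.\<close>
    define w where "w = restrict (\<lambda>(k, m).
      if piece_at D k m XPos then ?\<psi> (c (over D k m)) (c (lower D k m))
      else ?\<phi> (c (over D k m)) (c (lower D k m))) (crossings D)"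
    have cG: "c \<in> arcs D \<rightarrow>\<^sub>E carrier G"
      using c by (simp add: rack_colourings_def)
    have "w \<in> crossings D \<rightarrow>\<^sub>E carrier G"
      using in_G[OF cG] by (auto simp: w_def crossings_def rack_psi_def rack_phi_def)
    moreover have "\<not> piece_at D k m XPos" if "piece_at D k m XNeg" for k m
      using that by (simp add: piece_at_def)
    ultimately have "(c, w) \<in> ?C"
      using c in_G[OF cG] unfolding reidemeister_colourings_def rack_colourings_def car
      by (auto simp: upper_pos_rack upper_neg_rack w_def crossings_def)
    then show "c \<in> fst ` ?C"
      by (metis fst_conv image_eqI)
  qed
qed

lemma state_sum_rack:
  assumes "link_diagram D"
  shows "state_sum (conj_xmod G) (rack_psi G lop) (rack_phi G rop) D
    = frag_cmul (int (rack_count (carrier G) lop rop D)) (frag_of \<one>)"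
proof -
  let ?C = "reidemeister_colourings (conj_xmod G) (rack_psi G lop) (rack_phi G rop) D"
  have "state_sum (conj_xmod G) (rack_psi G lop) (rack_phi G rop) D = (\<Sum>F \<in> ?C. frag_of \<one>)"
    unfolding state_sum_def
  proof (rule sum.cong)
    fix F assume "F \<in> ?C"
    \<comment> \<open>Since \<open>bd\<close> is the identity map here, trivial boundary means that
      the evaluation itself is trivial.\<close>
    from crossed_module.bd_evaluation[OF crossed_module_conj_xmod[OF group_axioms] this assms]
    show "frag_of (snd (evaluation (conj_xmod G) D F)) = frag_of \<one>"
      by (simp add: conj_xmod_def)
  qed simp
  also have "\<dots> = frag_cmul (int (card ?C)) (frag_of \<one>)"
    by (rule sum_frag_const)
  also have "card ?C = rack_count (carrier G) lop rop D"
    unfolding rack_count_def by (rule bij_betw_same_card[OF bij_betw_colourings])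
  finally show ?thesis .
qed

end

theorem theorem4p4:
  fixes G :: "'a monoid"
    and lop rop :: "'a \<Rightarrow> 'a \<Rightarrow> 'a"
  assumes "rack (carrier G) lop rop"
    and "finite (carrier G)"
    and "group G"
  shows "crossed_module (conj_xmod G)
    \<and> framed_reidemeister_pair (conj_xmod G) (rack_psi G lop) (rack_phi G rop)
    \<and> (\<forall>D. link_diagram D \<longrightarrow>
          state_sum (conj_xmod G) (rack_psi G lop) (rack_phi G rop) D
            = frag_cmul (int (rack_count (carrier G) lop rop D)) (frag_of \<one>\<^bsub>G\<^esub>))
    \<and> (\<forall>D D'. link_diagram D \<and> link_diagram D' \<and>
          rack_count (carrier G) lop rop D \<noteq> rack_count (carrier G) lop rop D' \<longrightarrow>
          state_sum (conj_xmod G) (rack_psi G lop) (rack_phi G rop) D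
            \<noteq> state_sum (conj_xmod G) (rack_psi G lop) (rack_phi G rop) D')"
proof -
  interpret group_rack G lop rop
    using assms by (simp add: group_rack_def)
  \<comment> \<open>The integer coefficient at the unit of \<open>G\<close> recovers the number of
    colourings.\<close>
  have "rack_count (carrier G) lop rop D = rack_count (carrier G) lop rop D'"
    if "frag_cmul (int (rack_count (carrier G) lop rop D)) (frag_of \<one>\<^bsub>G\<^esub>)
      = frag_cmul (int (rack_count (carrier G) lop rop D')) (frag_of \<one>\<^bsub>G\<^esub>)" for D D'
    using arg_cong[OF that, of "\<lambda>x. Poly_Mapping.lookup x \<one>\<^bsub>G\<^esub>"] by simp
  then show ?thesis
    using crossed_module_conj_xmod[OF assms(3)] framed_reidemeister_pair_rack state_sum_rack by metis
qed

end
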